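(* Let $c_{\min}\in(0,1)$, and for $h\in[0,\infty)$ and $\rho\in[0,1-c_{\min}]$ put $\pi(h,\rho)=E\{\Phi(h(\rho\chi_1^2+1-\rho)^{-1/2}-z_\alpha)\}$ and $\Delta\pi(h,\rho)=\pi(h,\rho)-\pi(h,0)$. Then: 1. (Power gain with small signal) Given $\rho\in(0,1-c_{\min}]$, if $h\le\frac12\sqrt{1-\rho}\,\big(z_\alpha+\sqrt{z_\alpha^2+12}\big)$, then $\Delta\pi(h,\rho)>0$. 2. (Power loss with large signal) Given $\rho\in(0,1-c_{\min}]$, if $$h>\max\left(2z_\alpha,\ \Big\{z_\alpha\int_1^\infty f(t)\big[1-(\rho t+1-\rho)^{-1/2}\big]\,dt\Big\}^{-1}\mathrm{pr}(\chi_1^2<1)\right),$$ then $\Delta\pi(h,\rho)<0$. 3. (Diminishing power difference) Given $\rho\in[0,1-c_{\min}]$, we have $\lim_{h\to\infty}\Delta\pi(h,\rho)=0$.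
   Context: $\Phi$ is the $\mathcal N(0,1)$ distribution function; $z_\alpha$ is the upper $\alpha$ quantile of $\mathcal N(0,1)$; $\chi_1^2$ is a chi-squared random variable with one degree of freedom and $f$ is its density; the expectation in $\pi(h,\rho)$ is over $\chi_1^2$. Here $\pi(h,\rho)$ is the asymptotic power approximation of the one-sided level-$\alpha$ least-squares $t$ test of a zero regression coefficient with random regressors and normal errors with exchangeable correlation matrix $\rho 1_n1_n^{\top}+(1-\rho)I_n$ ($1_n$ the all-ones vector), and $h$ is the signal strength in the coefficient.
   Formalization: Part 1 is stated for h > 0, since Δπ(0,ρ) = 0; part 2 is stated for α < 1/2 (z_α > 0), since the threshold is undefined at z_α = 0 and for z_α < 0 it is negative, so the claim would fail at h = 0. *)

theory Defs
  imports "HOL-Probability.Probability"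
begin

definition std_normal_cdf :: "real \<Rightarrow> real" where
  "std_normal_cdf = cdf std_normal_distribution"

definition z_upper :: "real \<Rightarrow> real" where
  "z_upper \<alpha> = (THE z. measure std_normal_distribution {z<..} = \<alpha>)"

text \<open>The law of the square of a standard normal variable.\<close>

definition chi_square_1 :: "real measure" where
  "chi_square_1 = distr std_normal_distribution borel (\<lambda>x. x\<^sup>2)"

definition chi_square_1_density :: "real \<Rightarrow> real" where
  "chi_square_1_density t = (if 0 < t then exp (- t / 2) / sqrt (2 * pi * t) else 0)"

definition asym_power :: "real \<Rightarrow> real \<Rightarrow> real \<Rightarrow> real" where
  "asym_power \<alpha> h \<rho> =
     (\<integral>x. std_normal_cdf (h * (\<rho> * x + 1 - \<rho>) powr (- 1 / 2) - z_upper \<alpha>) \<partial>chi_square_1)"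

definition asym_power_diff :: "real \<Rightarrow> real \<Rightarrow> real \<Rightarrow> real" where
  "asym_power_diff \<alpha> h \<rho> = asym_power \<alpha> h \<rho> - asym_power \<alpha> h 0"

lemma chi_square_1_density_nonneg: "0 \<le> chi_square_1_density t"
  by (simp add: chi_square_1_density_def)

lemma borel_measurable_chi_square_1_density [measurable]:
  "chi_square_1_density \<in> borel_measurable borel"
  unfolding chi_square_1_density_def[abs_def] by measurable

lemma emeasure_chi_square_1_bounded:
  fixes A :: "real set" and n :: nat
  assumes A [measurable]: "A \<in> sets borel" and n: "n > 0"
  shows "emeasure chi_square_1 (A \<inter> {..(real n)\<^sup>2}) =
    emeasure (density lborel chi_square_1_density) (A \<inter> {..(real n)\<^sup>2})"
proof -
  define r where "r = real n"
  have r: "r > 0" using n by (simp add: r_def)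
  let ?F = "\<lambda>t. ennreal (chi_square_1_density t) * indicator A t"
  let ?G = "\<lambda>x. ennreal (std_normal_density x) * indicator A (x\<^sup>2)"
  have "emeasure chi_square_1 (A \<inter> {..r\<^sup>2}) =
      (\<integral>\<^sup>+x. ennreal (std_normal_density x) * indicator ((\<lambda>x. x\<^sup>2) -` (A \<inter> {..r\<^sup>2})) x \<partial>lborel)"
    unfolding chi_square_1_def by (subst emeasure_distr) (simp_all add: emeasure_density)
  also have "\<dots> = (\<integral>\<^sup>+x. ?G x * indicator {-r..r} x \<partial>lborel)"
  proof (intro nn_integral_cong)
    fix x :: real
    have "x\<^sup>2 \<le> r\<^sup>2 \<longleftrightarrow> x \<in> {-r..r}"
      using abs_le_square_iff[of x r] r by auto
    then show "ennreal (std_normal_density x) * indicator ((\<lambda>x. x\<^sup>2) -` (A \<inter> {..r\<^sup>2})) x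
      = ?G x * indicator {-r..r} x"
      by (auto simp: indicator_def)
  qed
  also have "\<dots> = (\<integral>\<^sup>+x. ?G x * indicator {0..r} x + ?G x * indicator {-r..0} x \<partial>lborel)"
    by (intro nn_integral_cong_AE, use AE_lborel_singleton[of 0] in eventually_elim)
       (auto simp: indicator_def)
  also have "\<dots> = (\<integral>\<^sup>+x. ?G x * indicator {0..r} x \<partial>lborel) + (\<integral>\<^sup>+x. ?G x * indicator {-r..0} x \<partial>lborel)"
    by (intro nn_integral_add) auto
  also have "(\<integral>\<^sup>+x. ?G x * indicator {-r..0} x \<partial>lborel) = (\<integral>\<^sup>+x. ?G x * indicator {0..r} x \<partial>lborel)"
    by (subst nn_integral_real_affine[where c = "-1" and t = 0])
       (auto simp: indicator_def normal_density_def intro!: nn_integral_cong)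
  also have "(\<integral>\<^sup>+x. ?G x * indicator {0..r} x \<partial>lborel) + (\<integral>\<^sup>+x. ?G x * indicator {0..r} x \<partial>lborel)
      = (\<integral>\<^sup>+x. ?G x * indicator {0..r} x + ?G x * indicator {0..r} x \<partial>lborel)"
    by (intro nn_integral_add[symmetric]) auto
  also have "\<dots> = (\<integral>\<^sup>+x. ?F (x\<^sup>2) * ennreal (2 * x) * indicator {0..r} x \<partial>lborel)"
  proof (intro nn_integral_cong_AE, use AE_lborel_singleton[of 0] in eventually_elim)
    fix x :: real assume "x \<noteq> 0"
    show "?G x * indicator {0..r} x + ?G x * indicator {0..r} x
      = ?F (x\<^sup>2) * ennreal (2 * x) * indicator {0..r} x"
    proof (cases "x \<in> {0..r} \<and> x\<^sup>2 \<in> A")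
      case True
      then have x: "x > 0" using \<open>x \<noteq> 0\<close> by auto
      have "std_normal_density x + std_normal_density x = chi_square_1_density (x\<^sup>2) * (2 * x)"
        using x by (simp add: chi_square_1_density_def std_normal_density_def real_sqrt_mult field_simps)
      then show ?thesis using True x
        by (simp add: ennreal_mult'[symmetric] ennreal_plus[symmetric] chi_square_1_density_nonneg del: ennreal_plus)
    qed (auto simp: indicator_def)
  qed
  also have "\<dots> = (\<integral>\<^sup>+t. ?F t * indicator {0\<^sup>2..r\<^sup>2} t \<partial>lborel)"
    by (rule nn_integral_substitution_aux[symmetric, where g = "\<lambda>x. x\<^sup>2" and g' = "\<lambda>x. 2 * x"])
       (use r in \<open>auto intro!: continuous_intros derivative_eq_intros\<close>)
  also have "\<dots> = (\<integral>\<^sup>+t. ennreal (chi_square_1_density t) * indicator (A \<inter> {..r\<^sup>2}) t \<partial>lborel)"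
    by (intro nn_integral_cong) (auto simp: indicator_def chi_square_1_density_def)
  also have "\<dots> = emeasure (density lborel chi_square_1_density) (A \<inter> {..r\<^sup>2})"
    by (simp add: emeasure_density)
  finally show ?thesis by (simp add: r_def)
qed

lemma chi_square_1_eq_density: "chi_square_1 = density lborel chi_square_1_density"
proof (rule measure_eqI)
  fix A assume "A \<in> sets chi_square_1"
  then have A [measurable]: "A \<in> sets borel" by (simp add: chi_square_1_def)
  let ?B = "\<lambda>n. A \<inter> {..(real (Suc n))\<^sup>2}"
  have U: "(\<Union>n. ?B n) = A"
  proof (intro equalityI subsetI)
    fix x assume "x \<in> A"
    obtain n where "x \<le> real n" using real_arch_simple by blast
    also have "real n \<le> (real (Suc n))\<^sup>2"
      by (simp add: power2_eq_square field_simps)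
    finally show "x \<in> (\<Union>n. ?B n)" using \<open>x \<in> A\<close> by blast
  qed auto
  have I: "incseq ?B"
    by (intro monoI Int_mono order_refl) (auto intro!: power_mono elim!: order_trans)
  have "emeasure chi_square_1 A = (SUP n. emeasure chi_square_1 (?B n))"
    by (subst SUP_emeasure_incseq[OF _ I], unfold U) (auto simp: chi_square_1_def)
  also have "\<dots> = (SUP n. emeasure (density lborel chi_square_1_density) (?B n))"
    by (intro SUP_cong refl emeasure_chi_square_1_bounded) auto
  also have "\<dots> = emeasure (density lborel chi_square_1_density) A"
    by (subst SUP_emeasure_incseq[OF _ I], unfold U) auto
  finally show "emeasure chi_square_1 A = emeasure (density lborel chi_square_1_density) A" .
qed (simp add: chi_square_1_def)

lemma ex1_upper_quantile:
  fixes \<alpha> :: real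
  assumes "0 < \<alpha>" "\<alpha> < 1"
  shows "\<exists>!z. measure std_normal_distribution {z<..} = \<alpha>"
proof -
  interpret real_distribution std_normal_distribution by (rule real_dist_normal_dist)
  have *: "measure std_normal_distribution {z<..} = 1 - cdf std_normal_distribution z" for z
    using prob_compl[of "{..z}"] by (simp add: cdf_def Compl_eq_Diff_UNIV[symmetric] Compl_atMost)
  have c: "isCont (cdf std_normal_distribution) z" for z
  proof -
    have "emeasure std_normal_distribution {z} = 0"
      by (subst emeasure_density) (auto simp: nn_integral_0_iff_AE intro!: AE_I[where N="{z}"] split: split_indicator)
    then show ?thesis by (simp add: isCont_cdf measure_def)
  qed
  have strict: "cdf std_normal_distribution a < cdf std_normal_distribution b" if "a < b" for a b
  proof -
    have "measure std_normal_distribution {a<..b} \<noteq> 0"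
    proof
      assume "measure std_normal_distribution {a<..b} = 0"
      then have "emeasure std_normal_distribution {a<..b} = 0"
        by (simp add: emeasure_eq_measure)
      then have "AE x in lborel. x \<notin> {a<..b}"
        using normal_density_pos[of 1 0]
        by (auto simp: emeasure_density nn_integral_0_iff_AE indicator_def
              ennreal_eq_0_iff not_le[symmetric] elim!: eventually_mono split: if_splits)
      then have "emeasure lborel {a<..b} = 0"
        by (subst (asm) AE_iff_measurable[of "{a<..b}"]) auto
      then show False using that by simp
    qed
    then show ?thesis
      using cdf_diff_eq[OF that] measure_nonneg[of std_normal_distribution "{a<..b}"] by linarith
  qed
  have "eventually (\<lambda>x. cdf std_normal_distribution x < 1 - \<alpha>) at_bot"
    using order_tendstoD(2)[OF cdf_lim_at_bot, of "1 - \<alpha>"] assms by simp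
  then obtain a where a: "cdf std_normal_distribution a < 1 - \<alpha>"
    by (auto simp: eventually_at_bot_linorder)
  have "eventually (\<lambda>x. cdf std_normal_distribution x > 1 - \<alpha>) at_top"
    using order_tendstoD(1)[OF cdf_lim_at_top_prob, of "1 - \<alpha>"] assms by simp
  then obtain b where b: "cdf std_normal_distribution b > 1 - \<alpha>"
    by (auto simp: eventually_at_top_linorder)
  have "a \<le> b" using a b cdf_nondecreasing[of b a] by (cases "a \<le> b") auto
  then obtain z where "cdf std_normal_distribution z = 1 - \<alpha>"
    using IVT[of "cdf std_normal_distribution" a "1 - \<alpha>" b] a b c by auto
  then show ?thesis
    unfolding * by (intro ex1I[of _ z]) (auto, metis strict linorder_neqE_linordered_idom less_irrefl diff_eq_eq add.commute diff_add_cancel)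
qed

lemma measure_above_z_upper:
  assumes "0 < \<alpha>" "\<alpha> < 1"
  shows "measure std_normal_distribution {z_upper \<alpha><..} = \<alpha>"
  unfolding z_upper_def by (rule theI'[OF ex1_upper_quantile[OF assms]])

end

theory Submission
  imports Defs
begin

text \<open>
  Write \<open>G v = \<Phi> (h / sqrt v - z)\<close>, where \<open>z\<close> is the upper \<open>\<alpha>\<close> quantile, and
  \<open>V = \<rho> \<chi> + 1 - \<rho>\<close> for the chi-squared variable \<open>\<chi>\<close>.  Then the power at \<open>\<rho>\<close> is
  \<open>E (G V)\<close>.  Since \<open>E \<chi> = 1\<close>, also \<open>E V = 1\<close>, while at \<open>\<rho> = 0\<close> the variable \<open>V\<close> is
  constantly \<open>1\<close>.  The power difference \<open>E (G V) - G (E V)\<close> is thus a Jensen gap.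

  For small \<open>h\<close> it is positive because \<open>G\<close> is strictly convex where \<open>V\<close> lives.  With
  \<open>w = h / sqrt v\<close>, the second derivative of \<open>G\<close> has the sign of \<open>3 - w (w - z)\<close>
  (\<open>power_slope_DERIV\<close>), so it is positive as long as \<open>w\<close> is below the larger root
  \<open>(z + sqrt (z\<^sup>2 + 12)) / 2\<close> of this quadratic.  As \<open>V > 1 - \<rho>\<close> almost surely, the bound
  on \<open>h\<close> says exactly that \<open>w\<close> stays there.  Integrating the tangent inequality at
  \<open>v = 1\<close> gives the gain.

  For large \<open>h\<close> the gain on \<open>\<chi> < 1\<close> is at most the upper tail of the normal law beyond
  \<open>h - z\<close>, hence at most \<open>\<phi> (h - z) / (h - z)\<close> by Mills' inequality
  (\<open>normal_tail_bound\<close>).  The loss on \<open>\<chi> \<ge> 1\<close> is the normal mass between \<open>h / sqrt V - z\<close>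
  and \<open>h - z\<close>.  When \<open>h > 2 z\<close>, this interval lies inside \<open>[-(h - z), h - z]\<close>, where the
  density is at least \<open>\<phi> (h - z)\<close>, so the loss is at least
  \<open>\<phi> (h - z) h (1 - 1 / sqrt V)\<close> (\<open>std_normal_cdf_increment_ge\<close>).  The factor
  \<open>\<phi> (h - z)\<close> is common to both bounds.  With \<open>P\<close> the probability of \<open>\<chi> < 1\<close> and \<open>I\<close> the
  integral in the statement, the loss wins as soon as \<open>P / (h - z) < h I\<close>; and
  \<open>h - z > z\<close> reduces this to the assumed bound \<open>h > P / (z I)\<close>.

  Finally \<open>V > 0\<close> almost surely, so \<open>G V\<close> tends to \<open>1\<close> as \<open>h\<close> grows; by dominated
  convergence both powers tend to \<open>1\<close> and their difference vanishes.
\<close>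

section \<open>The standard normal distribution function\<close>

lemma std_normal_cdf_DERIV: "DERIV std_normal_cdf x :> std_normal_density x"
proof -
  interpret real_distribution std_normal_distribution by (rule real_dist_normal_dist)
  \<comment> \<open>Any base point below \<open>x\<close> serves for the fundamental theorem of calculus.\<close>
  define a where "a = x - 1"
  have cont: "continuous_on S std_normal_density" for S
    unfolding std_normal_density_def by (intro continuous_intros) auto
  have eq: "std_normal_cdf y = std_normal_cdf a + integral {a..y} std_normal_density"
    if "a < y" for y
  proof -
    have int: "set_integrable lborel {a..y} std_normal_density"
      by (rule borel_integrable_atLeastAtMost'[OF cont])
    have "std_normal_cdf y - std_normal_cdf a = measure std_normal_distribution {a<..y}"
      unfolding std_normal_cdf_def by (rule cdf_diff_eq[OF that])
    also have "\<dots> = (\<integral>t. indicator {a<..y} t \<partial>std_normal_distribution)"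
      by simp
    also have "\<dots> = (\<integral>t. std_normal_density t * indicator {a<..y} t \<partial>lborel)"
      by (subst integral_density) auto
    also have "\<dots> = (LBINT t:{a..y}. std_normal_density t)"
      unfolding set_lebesgue_integral_def
      by (intro integral_cong_AE, measurable)
         (use AE_lborel_singleton[of a] in \<open>auto elim!: eventually_mono simp: indicator_def\<close>)
    also have "\<dots> = integral {a..y} std_normal_density"
      by (rule set_borel_integral_eq_integral(2)[OF int])
    finally show ?thesis by simp
  qed
  have "((\<lambda>y. integral {a..y} std_normal_density) has_real_derivative std_normal_density x)
      (at x within {a..x + 1})"
    by (rule integral_has_real_derivative[OF cont]) (simp add: a_def)
  then have "((\<lambda>y. std_normal_cdf a + integral {a..y} std_normal_density)
      has_real_derivative std_normal_density x) (at x within {a<..<x + 1})"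
    by (auto intro!: derivative_eq_intros elim: DERIV_subset)
  then have "((\<lambda>y. std_normal_cdf a + integral {a..y} std_normal_density)
      has_real_derivative std_normal_density x) (at x)"
    by (subst (asm) at_within_open) (auto simp: a_def)
  then show ?thesis
    by (rule has_field_derivative_transform_within_open[where S = "{a<..}"])
       (auto simp: a_def eq[unfolded a_def])
qed

lemma std_normal_density_DERIV:
  "DERIV std_normal_density x :> - x * std_normal_density x"
proof -
  have "DERIV (\<lambda>x. (1 / sqrt (2 * pi)) * exp (- x\<^sup>2 / 2)) x :>
      (1 / sqrt (2 * pi)) * (exp (- x\<^sup>2 / 2) * (- x))"
    by (intro DERIV_cmult DERIV_chain2[OF DERIV_exp]) (auto intro!: derivative_eq_intros)
  then show ?thesis unfolding std_normal_density_def[abs_def] by (simp add: mult_ac)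
qed

lemma std_normal_density_antimono_abs:
  assumes "\<bar>s\<bar> \<le> \<bar>t\<bar>"
  shows "std_normal_density t \<le> std_normal_density s"
  using abs_le_square_iff[of s t] assms
  by (auto simp: std_normal_density_def intro!: divide_right_mono)

lemma std_normal_cdf_nonneg: "0 \<le> std_normal_cdf x"
  and std_normal_cdf_le_1: "std_normal_cdf x \<le> 1"
  and std_normal_cdf_mono: "mono std_normal_cdf"
  and std_normal_cdf_at_top: "(std_normal_cdf \<longlongrightarrow> 1) at_top"
proof -
  interpret real_distribution std_normal_distribution by (rule real_dist_normal_dist)
  show "0 \<le> std_normal_cdf x" "std_normal_cdf x \<le> 1" "mono std_normal_cdf"
    "(std_normal_cdf \<longlongrightarrow> 1) at_top"
    by (auto simp: std_normal_cdf_def cdf_nonneg cdf_bounded_prob cdf_lim_at_top_prob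
        intro!: monoI cdf_nondecreasing)
qed

lemma borel_measurable_std_normal_cdf [measurable]: "std_normal_cdf \<in> borel_measurable borel"
  by (rule borel_measurable_mono[OF std_normal_cdf_mono])

text \<open>
  Mills' inequality, with the tail cut off at \<open>b\<close>: the function \<open>\<Phi> x + \<phi> x / x\<close> has derivative
  \<open>- \<phi> x / x\<^sup>2\<close>, so it is decreasing, and its value at \<open>b\<close> exceeds \<open>\<Phi> b\<close>.  A finite \<open>b\<close>
  avoids limits and is all that a comparison of two values of \<open>\<Phi>\<close> asks for.
\<close>

lemma normal_tail_bound:
  assumes "0 < t" "t \<le> b"
  shows "std_normal_cdf b - std_normal_cdf t \<le> std_normal_density t / t"
proof -
  let ?m = "\<lambda>x. std_normal_cdf x + std_normal_density x / x"
  have "?m b \<le> ?m t"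
  proof (rule DERIV_nonpos_imp_nonincreasing[OF assms(2)])
    fix x assume "t \<le> x" "x \<le> b"
    then have x: "0 < x" using assms by simp
    have "DERIV ?m x :> - (std_normal_density x / x\<^sup>2)"
      by (rule DERIV_cong[OF DERIV_add[OF std_normal_cdf_DERIV
            DERIV_divide[OF std_normal_density_DERIV DERIV_ident]]])
         (use x in \<open>simp_all add: field_simps power2_eq_square\<close>)
    then show "\<exists>y. DERIV ?m x :> y \<and> y \<le> 0" by (intro exI conjI) auto
  qed
  moreover have "0 \<le> std_normal_density b / b" using assms by auto
  ultimately show ?thesis by linarith
qed

text \<open>On \<open>[-t, t]\<close> the density is smallest at the end points, so the increment of \<open>\<Phi>\<close> over
  a subinterval ending in \<open>t\<close> is at least its length times \<open>\<phi> t\<close>.\<close>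

lemma std_normal_cdf_increment_ge:
  assumes "s \<le> t" "- t \<le> s"
  shows "std_normal_density t * (t - s) \<le> std_normal_cdf t - std_normal_cdf s"
proof (cases "s < t")
  case True
  obtain \<xi> where \<xi>: "s < \<xi>" "\<xi> < t"
    and eq: "std_normal_cdf t - std_normal_cdf s = (t - s) * std_normal_density \<xi>"
    using MVT2[OF True std_normal_cdf_DERIV] by blast
  have "std_normal_density t \<le> std_normal_density \<xi>"
    using \<xi> assms by (intro std_normal_density_antimono_abs) linarith
  then show ?thesis
    unfolding eq using True by (simp add: mult.commute mult_left_mono)
qed (use assms in auto)

text \<open>By symmetry the mass above \<open>0\<close> is \<open>1 / 2\<close>; a quantile at or below \<open>0\<close> would leave at
  least that much above it.\<close>

lemma z_upper_pos:
  assumes "0 < \<alpha>" "\<alpha> < 1 / 2"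
  shows "0 < z_upper \<alpha>"
proof (rule ccontr)
  interpret real_distribution std_normal_distribution by (rule real_dist_normal_dist)
  assume "\<not> 0 < z_upper \<alpha>"
  then have sub: "measure std_normal_distribution {0<..} \<le> \<alpha>"
    using finite_measure_mono[of "{0<..}" "{z_upper \<alpha><..}"] measure_above_z_upper[of \<alpha>] assms
    by auto
  \<comment> \<open>The substitution \<open>x \<mapsto> - x\<close> swaps the two half-lines.\<close>
  have "emeasure std_normal_distribution {0<..} = emeasure std_normal_distribution {..<0}"
    by (simp add: emeasure_density)
       (subst nn_integral_real_affine[where c = "-1" and t = 0],
        auto simp: indicator_def normal_density_def intro!: nn_integral_cong)
  then have sym: "measure std_normal_distribution {0<..} = measure std_normal_distribution {..<0}"
    by (simp add: measure_def)
  have "emeasure std_normal_distribution {0} = 0"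
    by (subst emeasure_density) (auto simp: nn_integral_0_iff_AE intro!: AE_I[where N="{0}"] split: split_indicator)
  then have zero: "measure std_normal_distribution {0} = 0" by (simp add: measure_def)
  have "1 = measure std_normal_distribution ({0<..} \<union> ({..<0} \<union> {0}))"
  proof -
    have "{0<..} \<union> ({..<0} \<union> {0}) = (UNIV :: real set)" by auto
    then show ?thesis using prob_space by simp
  qed
  also have "\<dots> = 2 * measure std_normal_distribution {0<..}"
  proof -
    have "measure std_normal_distribution ({0<..} \<union> ({..<0} \<union> {0}))
        = measure std_normal_distribution {0<..} + measure std_normal_distribution ({..<0} \<union> {0})"
      by (rule finite_measure_Union) auto
    moreover have "measure std_normal_distribution ({..<0} \<union> {0})
        = measure std_normal_distribution {..<0} + measure std_normal_distribution {0}"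
      by (rule finite_measure_Union) auto
    ultimately show ?thesis using sym zero by linarith
  qed
  finally show False using sub assms by linarith
qed

section \<open>The chi-squared distribution with one degree of freedom\<close>

lemma prob_space_chi_square_1: "prob_space chi_square_1"
proof -
  interpret real_distribution std_normal_distribution by (rule real_dist_normal_dist)
  show ?thesis unfolding chi_square_1_def by (rule prob_space_distr) auto
qed

lemma sets_chi_square_1 [measurable_cong, simp]: "sets chi_square_1 = sets borel"
  and space_chi_square_1 [simp]: "space chi_square_1 = UNIV"
  by (auto simp: chi_square_1_def)

lemma AE_chi_square_1_pos: "AE x in chi_square_1. 0 < x"
  unfolding chi_square_1_eq_density
  by (subst AE_density) (auto simp: chi_square_1_density_def)

lemma AE_chi_square_1_neq: "AE x in chi_square_1. x \<noteq> a"
  unfolding chi_square_1_eq_density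
  by (subst AE_density) (use AE_lborel_singleton[of a] in auto)

lemma chi_square_1_mean: "integrable chi_square_1 (\<lambda>x. x)" "(\<integral>x. x \<partial>chi_square_1) = 1"
proof -
  show "integrable chi_square_1 (\<lambda>x. x)"
    unfolding chi_square_1_def
    by (subst integrable_distr_eq) (auto intro: integrable_std_normal_distribution_moment)
  show "(\<integral>x. x \<partial>chi_square_1) = 1"
    unfolding chi_square_1_def
    using std_normal_distribution_even_moments(1)[of 1]
    by (subst integral_distr) (auto simp: fact_numeral)
qed

lemma integral_chi_square_1:
  fixes g :: "real \<Rightarrow> real"
  assumes [measurable]: "g \<in> borel_measurable borel"
  shows "(\<integral>x. g x \<partial>chi_square_1) = (\<integral>x. chi_square_1_density x * g x \<partial>lborel)"
  unfolding chi_square_1_eq_density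
  by (subst integral_density) (auto simp: chi_square_1_density_nonneg)

section \<open>Power gain for small signals\<close>

text \<open>The mean value theorem expresses \<open>f v - f m\<close> through the slope at a point strictly between
  \<open>m\<close> and \<open>v\<close>, and slopes increase strictly.  The strictness for \<open>v \<noteq> m\<close> is what makes the
  power gain positive rather than merely nonnegative.\<close>

lemma strictly_convex_above_tangent:
  fixes f f' f'' :: "real \<Rightarrow> real"
  assumes f: "\<And>x. c < x \<Longrightarrow> DERIV f x :> f' x"
    and f': "\<And>x. c < x \<Longrightarrow> DERIV f' x :> f'' x"
    and pos: "\<And>x. c < x \<Longrightarrow> 0 < f'' x"
    and "c < m" "c < v" "v \<noteq> m"
  shows "f m + f' m * (v - m) < f v"
proof -
  have strict: "f' a < f' b" if "c < a" "a < b" for a b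
    using that f' pos by (intro DERIV_pos_imp_increasing[OF that(2)]) (meson less_le_trans)
  show ?thesis
  proof (cases "m < v")
    case True
    then obtain \<xi> where "m < \<xi>" "f v - f m = (v - m) * f' \<xi>"
      using MVT2[OF True f] assms(4) by force
    moreover from this have "(v - m) * f' m < (v - m) * f' \<xi>"
      using True strict[of m \<xi>] assms by simp
    ultimately show ?thesis by (simp add: mult.commute)
  next
    case False
    then have vm: "v < m" using assms by simp
    then obtain \<xi> where "v < \<xi>" "\<xi> < m" "f m - f v = (m - v) * f' \<xi>"
      using MVT2[OF vm f] assms(5) by force
    moreover from this have "(m - v) * f' \<xi> < (m - v) * f' m"
      using vm strict[of \<xi> m] assms by simp
    ultimately show ?thesis by (simp add: algebra_simps)
  qed
qed

text \<open>The power of the test conditionally on the random scale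
  \<open>v = \<rho> \<chi> + 1 - \<rho>\<close>, for signal \<open>h\<close> and critical value \<open>z\<close>.\<close>

definition power_at :: "real \<Rightarrow> real \<Rightarrow> real \<Rightarrow> real" where
  "power_at z h v = std_normal_cdf (h * v powr (- 1 / 2) - z)"

text \<open>The derivative of \<^term>\<open>power_at z h\<close>.  The natural power \<open>v powr (- 3 / 2)\<close> is split
  as \<open>v powr (- 1 / 2) / v\<close>, so that \<open>v powr (- 1 / 2)\<close> is the only irrational term and
  differentiating once more leaves a rational identity.\<close>

definition power_slope :: "real \<Rightarrow> real \<Rightarrow> real \<Rightarrow> real" where
  "power_slope z h v =
     - (h * v powr (- 1 / 2) / (2 * v)) * std_normal_density (h * v powr (- 1 / 2) - z)"

lemma inverse_sqrt_DERIV: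
  fixes v :: real
  assumes "0 < v"
  shows "DERIV (\<lambda>v. v powr (- 1 / 2)) v :> - (v powr (- 1 / 2) / (2 * v))"
proof -
  have "v powr (- 1 / 2 - 1) = v powr (- 1 / 2) / v"
    using assms by (subst powr_diff) auto
  then show ?thesis
    using assms by (auto intro!: derivative_eq_intros)
qed

lemma signal_DERIV:
  fixes h v z :: real
  assumes "0 < v"
  shows "DERIV (\<lambda>v. h * v powr (- 1 / 2) - z) v :> - (h * v powr (- 1 / 2) / (2 * v))"
  by (rule DERIV_cong[OF DERIV_diff[OF DERIV_cmult[OF inverse_sqrt_DERIV[OF assms]] DERIV_const]]) simp

lemma power_at_DERIV:
  assumes "0 < v"
  shows "DERIV (power_at z h) v :> power_slope z h v"
  unfolding power_at_def[abs_def] power_slope_def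
  by (rule DERIV_cong[OF DERIV_chain2[OF std_normal_cdf_DERIV signal_DERIV[OF assms]]]) simp

text \<open>The curvature of the conditional power: all factors but \<open>3 - w * (w - z)\<close> are positive
  when \<open>h > 0\<close>, so that factor decides convexity.  The \<open>3\<close> comes from the curvature of
  \<open>v powr (- 1 / 2)\<close>, the other term from the derivative \<open>- y * \<phi> y\<close> of the normal density.\<close>

lemma power_slope_DERIV:
  fixes h v z :: real
  assumes "0 < v"
  defines "w \<equiv> h * v powr (- 1 / 2)"
  shows "DERIV (power_slope z h) v :>
    w / (4 * v\<^sup>2) * std_normal_density (w - z) * (3 - w * (w - z))"
proof -
  note signal = DERIV_cmult[OF inverse_sqrt_DERIV[OF assms(1)], of h]
  have lin: "DERIV (\<lambda>v. 2 * v) v :> 2"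
    using DERIV_cmult[OF DERIV_ident, of 2 v] by simp
  have "DERIV (power_slope z h) v :>
      - ((h * - (v powr (- 1 / 2) / (2 * v)) * (2 * v) - w * 2) / (2 * v * (2 * v)))
        * std_normal_density (w - z)
      + - (w - z) * std_normal_density (w - z) * - (w / (2 * v)) * - (w / (2 * v))"
    unfolding power_slope_def[abs_def] w_def
    by (rule DERIV_mult[OF DERIV_minus[OF DERIV_divide[OF signal lin]]
          DERIV_chain2[OF std_normal_density_DERIV signal_DERIV[OF assms(1)]]])
       (use assms(1) in simp)
  moreover have "h * - (v powr (- 1 / 2) / (2 * v)) = - (w / (2 * v))"
    by (simp add: w_def)
  ultimately have "DERIV (power_slope z h) v :>
      - ((- (w / (2 * v)) * (2 * v) - w * 2) / (2 * v * (2 * v))) * std_normal_density (w - z)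
      + - (w - z) * std_normal_density (w - z) * - (w / (2 * v)) * - (w / (2 * v))"
    by (simp only:)
  moreover have "- ((- (w / (2 * v)) * (2 * v) - w * 2) / (2 * v * (2 * v))) * e
      + - (w - z) * e * - (w / (2 * v)) * - (w / (2 * v))
      = w / (4 * v\<^sup>2) * e * (3 - w * (w - z))" for w e :: real
    using assms(1) by (simp add: divide_simps) (simp add: algebra_simps power2_eq_square)
  ultimately show ?thesis by (simp only:)
qed

text \<open>The upper bound on \<open>w\<close> is the larger root of \<open>w * (w - z) = 3\<close>; the smaller root is
  negative.  The proof multiplies the two linear factors, scaled by \<open>2\<close>.\<close>

lemma power_curvature_factor_pos:
  fixes w z :: real
  assumes "0 < w" "w < (z + sqrt (z\<^sup>2 + 12)) / 2"
  shows "0 < 3 - w * (w - z)"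
proof -
  define r where "r = sqrt (z\<^sup>2 + 12)"
  have r2: "r\<^sup>2 = z\<^sup>2 + 12" unfolding r_def by (simp add: add_nonneg_nonneg)
  have "\<bar>z\<bar> < r" unfolding r_def by (rule real_less_rsqrt) simp
  then have "0 < (r + z - 2 * w) * (r - z + 2 * w)"
    using assms by (intro mult_pos_pos) (auto simp: r_def[symmetric])
  also have "\<dots> = 4 * (3 - w * (w - z))"
    using r2 by (simp add: algebra_simps power2_eq_square)
  finally show ?thesis by simp
qed

lemma integrable_power_at:
  "integrable chi_square_1 (\<lambda>x. power_at z h (\<rho> * x + 1 - \<rho>))"
proof -
  interpret prob_space chi_square_1 by (rule prob_space_chi_square_1)
  show ?thesis unfolding power_at_def
    by (rule integrable_const_bound[where B = 1])
       (auto simp: std_normal_cdf_nonneg std_normal_cdf_le_1)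
qed

lemma asym_power_eq:
  "asym_power \<alpha> h \<rho> = (\<integral>x. power_at (z_upper \<alpha>) h (\<rho> * x + 1 - \<rho>) \<partial>chi_square_1)"
  by (simp add: asym_power_def power_at_def)

lemma asym_power_0: "asym_power \<alpha> h 0 = power_at (z_upper \<alpha>) h 1"
proof -
  interpret prob_space chi_square_1 by (rule prob_space_chi_square_1)
  show ?thesis unfolding asym_power_eq using prob_space by simp
qed

text \<open>Strict Jensen inequality at the mean \<open>1\<close> of \<open>\<rho> \<chi> + 1 - \<rho>\<close>: the linear term of the
  tangent there integrates to zero.\<close>

lemma small_signal_power_gain:
  assumes \<rho>: "0 < \<rho>" "\<rho> < 1" and h: "0 < h"
    and small: "h \<le> 1 / 2 * sqrt (1 - \<rho>) * (z_upper \<alpha> + sqrt ((z_upper \<alpha>)\<^sup>2 + 12))"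
  shows "0 < asym_power_diff \<alpha> h \<rho>"
proof -
  interpret prob_space chi_square_1 by (rule prob_space_chi_square_1)
  define z where "z = z_upper \<alpha>"
  let ?v = "\<lambda>x. \<rho> * x + 1 - \<rho>"
  let ?w = "\<lambda>v. h * v powr (- 1 / 2)"
  let ?T = "\<lambda>x. power_at z h 1 + power_slope z h 1 * (?v x - 1)"
  \<comment> \<open>The bound on \<open>h\<close> is the root bound for \<open>w\<close> at the end point \<open>v = 1 - \<rho>\<close>, where \<open>w\<close> is
    largest.\<close>
  have curv: "0 < ?w v / (4 * v\<^sup>2) * std_normal_density (?w v - z) * (3 - ?w v * (?w v - z))"
    if v: "1 - \<rho> < v" for v
  proof -
    have v0: "0 < v" using v \<rho> by simp
    have "v powr (- 1 / 2) = inverse (sqrt v)"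
      using v0 powr_minus[of v "1 / 2"] powr_half_sqrt[of v] by simp
    then have w: "?w v = h / sqrt v" by (simp only: divide_inverse)
    have "h / sqrt v < h / sqrt (1 - \<rho>)"
      using h v \<rho> by (intro divide_strict_left_mono mult_pos_pos) auto
    also have "\<dots> \<le> (z + sqrt (z\<^sup>2 + 12)) / 2"
      using small \<rho> by (simp add: z_def field_simps)
    finally have "0 < 3 - ?w v * (?w v - z)"
      unfolding w using h v0 by (intro power_curvature_factor_pos) auto
    then show ?thesis using h v0
      by (intro mult_pos_pos divide_pos_pos normal_density_pos) auto
  qed
  have tangent: "?T x < power_at z h (?v x)" if "0 < x" "x \<noteq> 1" for x
  proof (rule strictly_convex_above_tangent[where c = "1 - \<rho>", OF power_at_DERIV power_slope_DERIV curv])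
    show "?v x \<noteq> 1" using that \<rho> by (auto simp: algebra_simps)
  qed (use that \<rho> in auto)
  have int: "integrable chi_square_1 ?T"
    by (intro Bochner_Integration.integrable_add integrable_mult_right
        Bochner_Integration.integrable_diff integrable_const chi_square_1_mean)
  have "power_at z h 1 = (\<integral>x. ?T x \<partial>chi_square_1)"
    using prob_space by (simp add: chi_square_1_mean)
  also have "\<dots> < (\<integral>x. power_at z h (?v x) \<partial>chi_square_1)"
    by (rule integral_less_AE_space[OF int integrable_power_at])
       (use AE_chi_square_1_pos AE_chi_square_1_neq[of 1] in \<open>eventually_elim, use tangent in auto\<close>,
        simp add: emeasure_space_1[simplified])
  finally show ?thesis
    by (simp add: asym_power_diff_def asym_power_0 asym_power_eq[of \<alpha> h \<rho>] z_def)
qed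

section \<open>Power loss for large signals\<close>

text \<open>Without positivity of this integral the threshold for \<open>h\<close> would divide by zero and carry no
  information.  A vanishing integral of the nonnegative integrand would force the interval
  \<open>(1, 2)\<close>, on which density and integrand are positive, to be a null set.\<close>

lemma inverse_sqrt_deficit_integral_pos:
  assumes \<rho>: "0 < \<rho>" "\<rho> < 1"
  shows "0 < (\<integral>x. indicator {1..} x * (1 - (\<rho> * x + 1 - \<rho>) powr (- 1 / 2)) \<partial>chi_square_1)"
    (is "0 < (\<integral>x. ?g x \<partial>_)")
proof -
  interpret prob_space chi_square_1 by (rule prob_space_chi_square_1)
  have pos: "0 < ?g x" if "1 < x" for x
  proof -
    have "1 < \<rho> * x + 1 - \<rho>" using that \<rho> by simp
    then have "(\<rho> * x + 1 - \<rho>) powr (- 1 / 2) < 1 powr (- 1 / 2)"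
      by (intro powr_less_mono2_neg) auto
    then show ?thesis using that by simp
  qed
  have nn: "0 \<le> ?g x" for x
    using pos[of x] by (cases "x = 1") (auto simp: indicator_def)
  have int: "integrable chi_square_1 ?g"
    by (rule integrable_const_bound[where B = 1]) (use nn in \<open>auto simp: indicator_def\<close>)
  show ?thesis
  proof (rule ccontr)
    assume "\<not> ?thesis"
    then have "(\<integral>x. ?g x \<partial>chi_square_1) = 0"
      using Bochner_Integration.integral_nonneg[of chi_square_1 ?g, OF nn] by linarith
    then have "AE x in chi_square_1. ?g x = 0"
      using integral_nonneg_eq_0_iff_AE[OF int] nn by auto
    then have "AE x in lborel. 0 < chi_square_1_density x \<longrightarrow> ?g x = 0"
      unfolding chi_square_1_eq_density by (subst (asm) AE_density) auto
    then have "AE x in lborel. x \<notin> {1<..<2::real}"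
      by eventually_elim (use pos in \<open>force simp: chi_square_1_density_def\<close>)
    then have "emeasure lborel {1<..<2::real} = 0"
      by (subst (asm) AE_iff_measurable[of "{1<..<2}"]) auto
    then show False by simp
  qed
qed

text \<open>The two regimes meet at \<open>x = 1\<close>, where the scale is \<open>1\<close>.  Below it the power rises by at
  most the normal tail beyond \<open>h - z\<close>.  Above it \<open>h * u - z\<close> falls short of \<open>h - z\<close> but, by
  \<open>2 * z < h\<close>, stays above \<open>- (h - z)\<close>.\<close>

lemma power_change_bound:
  assumes \<rho>: "0 < \<rho>" "\<rho> < 1" and z: "0 < z" and h: "2 * z < h" and x: "0 < x"
  shows "power_at z h (\<rho> * x + 1 - \<rho>) - power_at z h 1 \<le>
    std_normal_density (h - z) / (h - z) * indicator {..<1} x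
    - std_normal_density (h - z) * h *
      (indicator {1..} x * (1 - (\<rho> * x + 1 - \<rho>) powr (- 1 / 2)))"
proof -
  define u where "u = (\<rho> * x + 1 - \<rho>) powr (- 1 / 2)"
  have v: "0 < \<rho> * x + 1 - \<rho>" using \<rho> x mult_pos_pos[of \<rho> x] by linarith
  have eq: "power_at z h (\<rho> * x + 1 - \<rho>) - power_at z h 1
      = std_normal_cdf (h * u - z) - std_normal_cdf (h - z)"
    by (simp add: power_at_def u_def)
  show ?thesis
  proof (cases "x < 1")
    case True
    then have "\<rho> * x + 1 - \<rho> \<le> 1" using \<rho> by simp
    then have "1 powr (- 1 / 2) \<le> u" unfolding u_def using v by (intro powr_mono2') auto
    then have "h - z \<le> h * u - z" using h z by simp
    then have "std_normal_cdf (h * u - z) - std_normal_cdf (h - z)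
        \<le> std_normal_density (h - z) / (h - z)"
      using h z by (intro normal_tail_bound) auto
    then show ?thesis unfolding eq using True by simp
  next
    case False
    then have "1 \<le> \<rho> * x + 1 - \<rho>" using \<rho> by simp
    then have "u \<le> 1 powr (- 1 / 2)" unfolding u_def by (intro powr_mono2') auto
    then have u: "0 \<le> u" "u \<le> 1" by (auto simp: u_def)
    then have hu: "0 \<le> h * u" "h * u \<le> h" using h z by (auto simp: mult_left_le)
    have "std_normal_density (h - z) * ((h - z) - (h * u - z))
        \<le> std_normal_cdf (h - z) - std_normal_cdf (h * u - z)"
      using hu h z by (intro std_normal_cdf_increment_ge) linarith+
    then show ?thesis unfolding eq u_def[symmetric] using False by (simp add: algebra_simps)
  qed
qed

lemma large_signal_power_loss:
  assumes \<rho>: "0 < \<rho>" "\<rho> < 1" and z: "0 < z_upper \<alpha>"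
    and large: "h > max (2 * z_upper \<alpha>)
      (inverse (z_upper \<alpha> *
         (LBINT t:{1..}. chi_square_1_density t * (1 - (\<rho> * t + 1 - \<rho>) powr (- 1 / 2))))
       * measure chi_square_1 {..<1})"
  shows "asym_power_diff \<alpha> h \<rho> < 0"
proof -
  interpret prob_space chi_square_1 by (rule prob_space_chi_square_1)
  define z where "z = z_upper \<alpha>"
  define P where "P = measure chi_square_1 {..<1}"
  let ?v = "\<lambda>x. \<rho> * x + 1 - \<rho>"
  let ?g = "\<lambda>x. indicator {1..} x * (1 - (?v x) powr (- 1 / 2))"
  define I where "I = (\<integral>x. ?g x \<partial>chi_square_1)"
  let ?d = "std_normal_density (h - z)"
  let ?B = "\<lambda>x. ?d / (h - z) * indicator {..<1} x - ?d * h * ?g x"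
  have I_eq: "I = (LBINT t:{1..}. chi_square_1_density t * (1 - (?v t) powr (- 1 / 2)))"
    unfolding I_def set_lebesgue_integral_def
    by (subst integral_chi_square_1) (auto intro!: Bochner_Integration.integral_cong)
  have I: "0 < I" unfolding I_def by (rule inverse_sqrt_deficit_integral_pos[OF \<rho>])
  have z0: "0 < z" and hz: "2 * z < h" and hP: "inverse (z * I) * P < h"
    using z large by (auto simp: z_def I_eq P_def)
  \<comment> \<open>A nonzero Bochner integral certifies integrability.\<close>
  have int_g: "integrable chi_square_1 ?g"
    using I unfolding I_def using not_integrable_integral_eq by fastforce
  have int_ind: "integrable chi_square_1 (indicator {..<1} :: real \<Rightarrow> real)"
    by (rule integrable_const_bound[where B = 1]) auto
  have "asym_power_diff \<alpha> h \<rho>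
      = (\<integral>x. power_at z h (?v x) - power_at z h 1 \<partial>chi_square_1)"
    using prob_space
    by (simp add: asym_power_diff_def asym_power_0 asym_power_eq[of \<alpha> h \<rho>] z_def
        Bochner_Integration.integral_diff[OF integrable_power_at])
  also have "\<dots> \<le> (\<integral>x. ?B x \<partial>chi_square_1)"
  proof (rule integral_mono_AE)
    show "AE x in chi_square_1. power_at z h (?v x) - power_at z h 1 \<le> ?B x"
      using AE_chi_square_1_pos
      by eventually_elim (rule power_change_bound[OF \<rho> z0 hz])
  qed (intro Bochner_Integration.integrable_diff integrable_power_at integrable_const
        integrable_mult_right int_g int_ind)+
  also have "\<dots> = ?d / (h - z) * P - ?d * h * I"
    using int_g int_ind by (simp add: I_def P_def)
  also have "\<dots> < 0"
  proof -
    \<comment> \<open>Here the threshold \<open>P / (z I)\<close> enters; \<open>2 * z < h\<close> then trades \<open>z\<close> for \<open>h - z\<close>.\<close>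
    have "P < h * (z * I)" using hP z0 I by (simp add: field_simps)
    also have "\<dots> \<le> h * ((h - z) * I)" using hz z0 I by simp
    finally have "P / (h - z) < h * I" using hz z0 by (simp add: field_simps)
    then have "?d * (P / (h - z)) < ?d * (h * I)" by (intro mult_strict_left_mono normal_density_pos) auto
    then show ?thesis by simp
  qed
  finally show ?thesis .
qed

section \<open>Vanishing of the power difference\<close>

text \<open>The power is bounded by \<open>1\<close>, and for almost every value of the scale, which is positive, the
  argument of \<open>\<Phi>\<close> grows linearly in \<open>h\<close>.\<close>

lemma asym_power_tendsto_1:
  assumes \<rho>: "0 \<le> \<rho>" "\<rho> < 1"
  shows "((\<lambda>h. asym_power \<alpha> h \<rho>) \<longlongrightarrow> 1) at_top"
proof -
  interpret prob_space chi_square_1 by (rule prob_space_chi_square_1)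
  have "((\<lambda>h. \<integral>x. power_at (z_upper \<alpha>) h (\<rho> * x + 1 - \<rho>) \<partial>chi_square_1)
      \<longlongrightarrow> (\<integral>x. 1 \<partial>chi_square_1)) at_top"
  proof (rule integral_dominated_convergence_at_top[where w = "\<lambda>_. 1"])
    show "AE x in chi_square_1.
        ((\<lambda>h. power_at (z_upper \<alpha>) h (\<rho> * x + 1 - \<rho>)) \<longlongrightarrow> 1) at_top"
      using AE_chi_square_1_pos
    proof eventually_elim
      case (elim x)
      have "0 < (\<rho> * x + 1 - \<rho>)" using \<rho> elim
        by (metis add_diff_eq add_nonneg_pos diff_gt_0_iff_gt less_imp_le mult_nonneg_nonneg)
      then have "filterlim (\<lambda>h. (- z_upper \<alpha>) + (\<rho> * x + 1 - \<rho>) powr (- 1 / 2) * h) at_top at_top"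
        by (intro filterlim_tendsto_add_at_top[OF tendsto_const]
            filterlim_tendsto_pos_mult_at_top[OF tendsto_const _ filterlim_ident]) auto
      from filterlim_compose[OF std_normal_cdf_at_top this]
      show ?case by (simp add: power_at_def mult.commute)
    qed
  qed (auto simp: power_at_def std_normal_cdf_nonneg std_normal_cdf_le_1)
  then show ?thesis using prob_space by (simp add: asym_power_eq)
qed

theorem lemmaC5:
  fixes \<alpha> c_min :: real
  assumes "0 < \<alpha>" and "\<alpha> < 1"
    and "0 < c_min" and "c_min < 1"
  shows
    "(\<forall>\<rho>\<in>{0<..1 - c_min}. \<forall>h>0.
        h \<le> 1 / 2 * sqrt (1 - \<rho>) * (z_upper \<alpha> + sqrt ((z_upper \<alpha>)\<^sup>2 + 12))
          \<longrightarrow> asym_power_diff \<alpha> h \<rho> > 0) \<and>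
     (\<alpha> < 1 / 2 \<longrightarrow> (\<forall>\<rho>\<in>{0<..1 - c_min}. \<forall>h\<ge>0.
        h > max (2 * z_upper \<alpha>)
              (inverse (z_upper \<alpha> *
                 (LBINT t:{1..}. chi_square_1_density t * (1 - (\<rho> * t + 1 - \<rho>) powr (- 1 / 2))))
               * measure chi_square_1 {..<1})
          \<longrightarrow> asym_power_diff \<alpha> h \<rho> < 0)) \<and>
     (\<forall>\<rho>\<in>{0..1 - c_min}. ((\<lambda>h. asym_power_diff \<alpha> h \<rho>) \<longlongrightarrow> 0) at_top)"
proof (intro conjI ballI allI impI)
  fix \<rho> h :: real
  assume "\<rho> \<in> {0<..1 - c_min}" "0 < h"
    and "h \<le> 1 / 2 * sqrt (1 - \<rho>) * (z_upper \<alpha> + sqrt ((z_upper \<alpha>)\<^sup>2 + 12))"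
  then show "0 < asym_power_diff \<alpha> h \<rho>"
    using assms by (intro small_signal_power_gain) auto
next
  fix \<rho> h :: real
  assume "\<alpha> < 1 / 2" "\<rho> \<in> {0<..1 - c_min}"
    and "h > max (2 * z_upper \<alpha>)
              (inverse (z_upper \<alpha> *
                 (LBINT t:{1..}. chi_square_1_density t * (1 - (\<rho> * t + 1 - \<rho>) powr (- 1 / 2))))
               * measure chi_square_1 {..<1})"
  then show "asym_power_diff \<alpha> h \<rho> < 0"
    using assms z_upper_pos[of \<alpha>] by (intro large_signal_power_loss) auto
next
  fix \<rho> :: real
  assume "\<rho> \<in> {0..1 - c_min}"
  then have "((\<lambda>h. asym_power \<alpha> h \<rho> - asym_power \<alpha> h 0) \<longlongrightarrow> 1 - 1) at_top"
    using assms by (intro tendsto_diff asym_power_tendsto_1) auto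
  then show "((\<lambda>h. asym_power_diff \<alpha> h \<rho>) \<longlongrightarrow> 0) at_top"
    by (simp add: asym_power_diff_def)
qed

end
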